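(* For every weight formula $\alpha$: $\mathtt{w}\mathsf{BD}\vdash\alpha$ if and only if $\alpha$ is valid (i.e. satisfied in every probabilistic BD model).
   Context: Fix a finite set $\mathtt{Prop}$; $\mathscr{L}_{\mathsf{BD}}$ is the set of formulas over $\mathtt{Prop}$ with $\neg,\wedge,\vee$. BD models $\langle W,v^+,v^-\rangle$ ($W\ne\varnothing$, $v^\pm:\mathtt{Prop}\to\mathcal P(W)$) with the Belnap–Dunn support relations $\vDash^+,\vDash^-$ ($w\vDash^\pm p$ iff $w\in v^\pm(p)$; $w\vDash^\pm\neg\varphi$ iff $w\vDash^\mp\varphi$; $\vDash^+$ of $\wedge$/$\vee$ is conjunctive/disjunctive, $\vDash^-$ of $\wedge$/$\vee$ is disjunctive/conjunctive); $\varphi\vdash_{\mathsf{BD}}\psi$ iff in every BD model every state positively supporting $\varphi$ positively supports $\psi$ and every state negatively supporting $\psi$ negatively supports $\varphi$. A probabilistic BD model is $\langle W,v^+,v^-,\mu\rangle$ with $\mu$ a classical probability measure on $\mathcal P(W)$; its mass function is $\mathtt m(w)=\mu(\{w\})$. A primitive weight formula is $\sum_{i=1}^n a_i\cdot\mathtt w^{\pm}(\phi_i)\ge c$ with $a_i,c\in\mathbb Z$, $\phi_i\in\mathscr{L}_{\mathsf{BD}}$, each term carrying either $\mathtt w^+$ or $\mathtt w^-$; weight formulas are Boolean combinations (with $\sim,\wedge$, and classically defined $\vee,\supset,\rightarrow$, etc.) of primitive weight formulas. Satisfaction: $\mathscr M\models\sum a_i\mathtt w^{\pm}(\phi_i)\ge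 c$ iff $\sum a_i\sum_{w\vDash^{\pm}\phi_i}\mathtt m(w)\ge c$ (where $\mathtt w^+$ uses $\vDash^+$ and $\mathtt w^-$ uses $\vDash^-$); $\sim,\wedge$ classical. Expressions $t\le c$, $t=c$, $t>c$, $\mathtt w(\phi)\le \mathtt w(\phi')$ etc. abbreviate the obvious weight formulas. The calculus $\mathtt w\mathsf{BD}$ has: all substitution instances (primitive weight formulas as atoms) of classical tautologies; modus ponens; all instances of valid formulas about linear inequalities over the reals (weight terms substituted for variables); W1: $\mathtt w^\pm(\phi)\ge0$, $\mathtt w^\pm(\phi)\le1$; W2: $\mathtt w^\mp(\phi)=\mathtt w^\pm(\neg\phi)$; W3: $\mathtt w^+(\bigvee_{i=1}^k\phi_i)=\sum_{\varnothing\ne J\subseteq\{1..k\}}(-1)^{|J|+1}\mathtt w^+(\bigwedge_{j\in J}\phi_j)$; W4: $\mathtt w^+(\phi)\le\mathtt w^+(\phi')$ and $\mathtt w^-(\phi)\ge\mathtt w^-(\phi')$ whenever $\phi\vdash_{\mathsf{BD}}\phi'$. *)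

theory Defs
  imports "HOL-Probability.Probability"
begin

section \<open>Belnap--Dunn logic\<close>

datatype 'p bd =
    BVar 'p
  | BNeg "'p bd"
  | BConj "'p bd" "'p bd"
  | BDisj "'p bd" "'p bd"

record ('p, 'w) bd_model =
  worlds :: "'w set"
  vpos :: "'p \<Rightarrow> 'w set"
  vneg :: "'p \<Rightarrow> 'w set"

definition is_bd_model :: "('p, 'w, 'e) bd_model_scheme \<Rightarrow> bool" where
  "is_bd_model M \<longleftrightarrow>
     worlds M \<noteq> {} \<and> (\<forall>p. vpos M p \<subseteq> worlds M) \<and> (\<forall>p. vneg M p \<subseteq> worlds M)"

fun supp_pos :: "('p, 'w, 'e) bd_model_scheme \<Rightarrow> 'w \<Rightarrow> 'p bd \<Rightarrow> bool"
  and supp_neg :: "('p, 'w, 'e) bd_model_scheme \<Rightarrow> 'w \<Rightarrow> 'p bd \<Rightarrow> bool" where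
  "supp_pos M w (BVar p) \<longleftrightarrow> w \<in> vpos M p"
| "supp_pos M w (BNeg \<phi>) \<longleftrightarrow> supp_neg M w \<phi>"
| "supp_pos M w (BConj \<phi> \<psi>) \<longleftrightarrow> supp_pos M w \<phi> \<and> supp_pos M w \<psi>"
| "supp_pos M w (BDisj \<phi> \<psi>) \<longleftrightarrow> supp_pos M w \<phi> \<or> supp_pos M w \<psi>"
| "supp_neg M w (BVar p) \<longleftrightarrow> w \<in> vneg M p"
| "supp_neg M w (BNeg \<phi>) \<longleftrightarrow> supp_pos M w \<phi>"
| "supp_neg M w (BConj \<phi> \<psi>) \<longleftrightarrow> supp_neg M w \<phi> \<or> supp_neg M w \<psi>"
| "supp_neg M w (BDisj \<phi> \<psi>) \<longleftrightarrow> supp_neg M w \<phi> \<and> supp_neg M w \<psi>"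

definition bd_entails_on :: "'w itself \<Rightarrow> 'p bd \<Rightarrow> 'p bd \<Rightarrow> bool" where
  "bd_entails_on (T :: 'w itself) \<phi> \<psi> \<longleftrightarrow>
     (\<forall>M :: ('p, 'w) bd_model. is_bd_model M \<longrightarrow>
        (\<forall>w \<in> worlds M. supp_pos M w \<phi> \<longrightarrow> supp_pos M w \<psi>) \<and>
        (\<forall>w \<in> worlds M. supp_neg M w \<psi> \<longrightarrow> supp_neg M w \<phi>))"

text \<open>HOL cannot quantify over all state types inside a definition, so the state type is a
  parameter above.  The following two facts show that it is immaterial.\<close>

lemma supp_local:
  fixes M :: "('p, 'w, 'e) bd_model_scheme" and N :: "('p, 'u, 'f) bd_model_scheme"
  assumes "\<And>p. w \<in> vpos M p \<longleftrightarrow> u \<in> vpos N p" "\<And>p. w \<in> vneg M p \<longleftrightarrow> u \<in> vneg N p"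
  shows "(supp_pos M w \<phi> \<longleftrightarrow> supp_pos N u \<phi>) \<and> (supp_neg M w \<phi> \<longleftrightarrow> supp_neg N u \<phi>)"
  using assms by (induction \<phi>) auto

lemma bd_entails_on_transfer:
  fixes \<phi> \<psi> :: "'p bd"
  assumes "bd_entails_on TYPE('u) \<phi> \<psi>"
  shows "bd_entails_on TYPE('w) \<phi> \<psi>"
proof -
  have "(supp_pos M w \<phi> \<longrightarrow> supp_pos M w \<psi>) \<and> (supp_neg M w \<psi> \<longrightarrow> supp_neg M w \<phi>)"
    for M :: "('p, 'w) bd_model" and w
  proof -
    define u :: 'u where "u = undefined"
    define N :: "('p, 'u) bd_model" where
      "N = \<lparr>worlds = {u}, vpos = (\<lambda>p. if w \<in> vpos M p then {u} else {}),
            vneg = (\<lambda>p. if w \<in> vneg M p then {u} else {})\<rparr>"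
    have "is_bd_model N" and "u \<in> worlds N"
      by (simp_all add: is_bd_model_def N_def)
    then have "supp_pos N u \<phi> \<longrightarrow> supp_pos N u \<psi>" "supp_neg N u \<psi> \<longrightarrow> supp_neg N u \<phi>"
      using assms unfolding bd_entails_on_def by blast+
    moreover have "(supp_pos M w \<theta> \<longleftrightarrow> supp_pos N u \<theta>) \<and> (supp_neg M w \<theta> \<longleftrightarrow> supp_neg N u \<theta>)" for \<theta>
      by (rule supp_local) (simp_all add: N_def)
    ultimately show ?thesis by blast
  qed
  then show ?thesis unfolding bd_entails_on_def by blast
qed

theorem bd_entails_on_type_independent:
  "bd_entails_on TYPE('u) \<phi> \<psi> \<longleftrightarrow> bd_entails_on TYPE('w) \<phi> \<psi>"
  by (rule iffI; erule bd_entails_on_transfer)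

abbreviation bd_entails :: "'p bd \<Rightarrow> 'p bd \<Rightarrow> bool" where
  "bd_entails \<equiv> bd_entails_on TYPE(nat)"

text \<open>Iterated connectives of a nonempty list, bracketed to the right.\<close>

fun big_conj :: "'p bd list \<Rightarrow> 'p bd" where
  "big_conj [\<phi>] = \<phi>"
| "big_conj (\<phi> # \<psi> # xs) = BConj \<phi> (big_conj (\<psi> # xs))"

fun big_disj :: "'p bd list \<Rightarrow> 'p bd" where
  "big_disj [\<phi>] = \<phi>"
| "big_disj (\<phi> # \<psi> # xs) = BDisj \<phi> (big_disj (\<psi> # xs))"


section \<open>Boolean combinations and linear inequalities\<close>

datatype 'a bform =
    FAtom 'a
  | FNot "'a bform"
  | FAnd "'a bform" "'a bform"

abbreviation Imp :: "'a bform \<Rightarrow> 'a bform \<Rightarrow> 'a bform" where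
  "Imp \<alpha> \<beta> \<equiv> FNot (FAnd \<alpha> (FNot \<beta>))"

primrec holds :: "('a \<Rightarrow> bool) \<Rightarrow> 'a bform \<Rightarrow> bool" where
  "holds V (FAtom a) \<longleftrightarrow> V a"
| "holds V (FNot \<alpha>) \<longleftrightarrow> \<not> holds V \<alpha>"
| "holds V (FAnd \<alpha> \<beta>) \<longleftrightarrow> holds V \<alpha> \<and> holds V \<beta>"

primrec bsubst :: "('a \<Rightarrow> 'b bform) \<Rightarrow> 'a bform \<Rightarrow> 'b bform" where
  "bsubst \<sigma> (FAtom a) = \<sigma> a"
| "bsubst \<sigma> (FNot \<alpha>) = FNot (bsubst \<sigma> \<alpha>)"
| "bsubst \<sigma> (FAnd \<alpha> \<beta>) = FAnd (bsubst \<sigma> \<alpha>) (bsubst \<sigma> \<beta>)"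

definition tautology :: "'a bform \<Rightarrow> bool" where
  "tautology \<alpha> \<longleftrightarrow> (\<forall>V. holds V \<alpha>)"

text \<open>\<open>Ineq [(a\<^sub>1, x\<^sub>1), \<dots>, (a\<^sub>n, x\<^sub>n)] c\<close> stands for
  \<open>a\<^sub>1 x\<^sub>1 + \<dots> + a\<^sub>n x\<^sub>n \<ge> c\<close>; the \<open>x\<^sub>i\<close> are real variables or weight terms.\<close>

datatype 'x ineq = Ineq "(int \<times> 'x) list" int

primrec ineq_true :: "('x \<Rightarrow> real) \<Rightarrow> 'x ineq \<Rightarrow> bool" where
  "ineq_true v (Ineq ts c) \<longleftrightarrow> (\<Sum>(a, x)\<leftarrow>ts. real_of_int a * v x) \<ge> real_of_int c"

definition valid_linear :: "'x ineq bform \<Rightarrow> bool" where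
  "valid_linear \<beta> \<longleftrightarrow> (\<forall>v :: 'x \<Rightarrow> real. holds (ineq_true v) \<beta>)"

abbreviation lin_ge :: "(int \<times> 'x) list \<Rightarrow> int \<Rightarrow> 'x ineq bform" where
  "lin_ge ts c \<equiv> FAtom (Ineq ts c)"

definition lin_le :: "(int \<times> 'x) list \<Rightarrow> int \<Rightarrow> 'x ineq bform" where
  "lin_le ts c = lin_ge (map (\<lambda>(a, x). (- a, x)) ts) (- c)"

definition lin_eq :: "(int \<times> 'x) list \<Rightarrow> int \<Rightarrow> 'x ineq bform" where
  "lin_eq ts c = FAnd (lin_ge ts c) (lin_le ts c)"

definition var_le :: "'x \<Rightarrow> 'x \<Rightarrow> 'x ineq bform" where
  "var_le x y = lin_le [(1, x), (-1, y)] 0"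

definition var_eq :: "'x \<Rightarrow> 'x \<Rightarrow> 'x ineq bform" where
  "var_eq x y = lin_eq [(1, x), (-1, y)] 0"


section \<open>Weight formulas and probabilistic BD models\<close>

datatype 'p wterm = Wpos "'p bd" | Wneg "'p bd"

type_synonym 'p wform = "'p wterm ineq bform"

record ('p, 'w) prob_bd_model = "('p, 'w) bd_model" +
  pr :: "'w measure"

definition is_prob_bd_model :: "('p, 'w, 'e) prob_bd_model_scheme \<Rightarrow> bool" where
  "is_prob_bd_model M \<longleftrightarrow> is_bd_model M \<and> prob_space (pr M) \<and>
     space (pr M) = worlds M \<and> sets (pr M) = Pow (worlds M)"

definition mass :: "('p, 'w, 'e) prob_bd_model_scheme \<Rightarrow> 'w \<Rightarrow> real" where
  "mass M w = measure (pr M) {w}"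

primrec weight :: "('p, 'w, 'e) prob_bd_model_scheme \<Rightarrow> 'p wterm \<Rightarrow> real" where
  "weight M (Wpos \<phi>) = (\<Sum>\<^sub>\<infinity>w\<in>{w \<in> worlds M. supp_pos M w \<phi>}. mass M w)"
| "weight M (Wneg \<phi>) = (\<Sum>\<^sub>\<infinity>w\<in>{w \<in> worlds M. supp_neg M w \<phi>}. mass M w)"

definition satisfies :: "('p, 'w, 'e) prob_bd_model_scheme \<Rightarrow> 'p wform \<Rightarrow> bool" where
  "satisfies M \<alpha> \<longleftrightarrow> holds (ineq_true (weight M)) \<alpha>"

definition valid_on :: "'w itself \<Rightarrow> 'p wform \<Rightarrow> bool" where
  "valid_on (T :: 'w itself) \<alpha> \<longleftrightarrow>
     (\<forall>M :: ('p, 'w) prob_bd_model. is_prob_bd_model M \<longrightarrow> satisfies M \<alpha>)"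


section \<open>The calculus\<close>

text \<open>In \<open>W3\<close>, \<open>subseqs \<phi>s\<close> lists the subfamilies \<open>(\<phi>\<^sub>j)\<close>, \<open>j \<in> J\<close>, once for each index set
  \<open>J\<close> (also when some of the \<open>\<phi>\<^sub>i\<close> coincide).  The inclusion-exclusion sum has been moved to
  the left-hand side, hence the sign \<open>(-1)\<close> to the power \<open>|J|\<close>.\<close>

inductive wBD :: "'p wform \<Rightarrow> bool" where
  Taut: "tautology (\<beta> :: nat bform) \<Longrightarrow> wBD (bsubst \<sigma> \<beta>)"
| MP: "wBD \<alpha> \<Longrightarrow> wBD (Imp \<alpha> \<beta>) \<Longrightarrow> wBD \<beta>"
| Lin: "valid_linear (\<gamma> :: nat ineq bform) \<Longrightarrow> wBD (map_bform (map_ineq \<tau>) \<gamma>)"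
| W1_pos_ge: "wBD (lin_ge [(1, Wpos \<phi>)] 0)"
| W1_pos_le: "wBD (lin_le [(1, Wpos \<phi>)] 1)"
| W1_neg_ge: "wBD (lin_ge [(1, Wneg \<phi>)] 0)"
| W1_neg_le: "wBD (lin_le [(1, Wneg \<phi>)] 1)"
| W2_neg: "wBD (var_eq (Wneg \<phi>) (Wpos (BNeg \<phi>)))"
| W2_pos: "wBD (var_eq (Wpos \<phi>) (Wneg (BNeg \<phi>)))"
| W3: "\<phi>s \<noteq> [] \<Longrightarrow>
    wBD (lin_eq ((1, Wpos (big_disj \<phi>s)) #
      [((-1) ^ length \<psi>s, Wpos (big_conj \<psi>s)). \<psi>s \<leftarrow> List.subseqs \<phi>s, \<psi>s \<noteq> []]) 0)"
| W4_pos: "bd_entails \<phi> \<phi>' \<Longrightarrow> wBD (var_le (Wpos \<phi>) (Wpos \<phi>'))"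
| W4_neg: "bd_entails \<phi> \<phi>' \<Longrightarrow> wBD (var_le (Wneg \<phi>') (Wneg \<phi>))"

end

theory Submission
  imports Defs
begin

text \<open>Completeness: a state of a BD model is determined, as far as support is concerned, by the
  pair of sets of variables it supports positively and negatively, and the sets of such pairs
  defined by formulas are exactly the up-sets other than \<open>{}\<close> and \<open>UNIV\<close>.  By W4 a valuation
  of the weight terms that satisfies the axioms is a monotone function \<open>g\<close> of these up-sets, and by
  W3 for two disjuncts it is modular.  Hence \<open>g\<close> is the up-set sum of the nonnegative mass
  \<open>m s = g {s..} - g {s<..}\<close>, which gives a model on the pairs.  Since there are finitely many
  up-sets, only finitely many axioms enter, and the rest is linear arithmetic.\<close>

section \<open>Soundness\<close>

lemma holds_bsubst: "holds V (bsubst \<sigma> \<beta>) \<longleftrightarrow> holds (\<lambda>a. holds V (\<sigma> a)) \<beta>"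
  by (induction \<beta>) auto

lemma ineq_true_map_ineq: "ineq_true v (map_ineq \<tau> i) \<longleftrightarrow> ineq_true (v \<circ> \<tau>) i"
  by (cases i) (simp add: o_def case_prod_unfold)

lemma holds_ineq_map: "holds (ineq_true v) (map_bform (map_ineq \<tau>) \<gamma>) \<longleftrightarrow> holds (ineq_true (v \<circ> \<tau>)) \<gamma>"
  by (induction \<gamma>) (simp_all add: ineq_true_map_ineq o_def)

lemma sum_list_uminus: "(\<Sum>(a, x)\<leftarrow>map (\<lambda>(a, x). (- a, x)) ts. real_of_int a * v x)
    = - (\<Sum>(a, x)\<leftarrow>ts. real_of_int a * v x)"
  by (induction ts) auto

lemma holds_lin_le:
  "holds (ineq_true v) (lin_le ts c) \<longleftrightarrow> (\<Sum>(a, x)\<leftarrow>ts. real_of_int a * v x) \<le> real_of_int c"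
  unfolding lin_le_def holds.simps ineq_true.simps sum_list_uminus by simp

lemma holds_lin_eq:
  "holds (ineq_true v) (lin_eq ts c) \<longleftrightarrow> (\<Sum>(a, x)\<leftarrow>ts. real_of_int a * v x) = real_of_int c"
  unfolding lin_eq_def by (auto simp: holds_lin_le)

lemma holds_var_le: "holds (ineq_true v) (var_le x y) \<longleftrightarrow> v x \<le> v y"
  by (simp add: var_le_def holds_lin_le)

lemma holds_var_eq: "holds (ineq_true v) (var_eq x y) \<longleftrightarrow> v x = v y"
  by (auto simp add: var_eq_def holds_lin_eq)

section \<open>Weights as sums of masses of supporting states\<close>

fun supports :: "('p, 'w, 'e) bd_model_scheme \<Rightarrow> 'w \<Rightarrow> 'p wterm \<Rightarrow> bool" where
  "supports M w (Wpos \<phi>) \<longleftrightarrow> supp_pos M w \<phi>"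
| "supports M w (Wneg \<phi>) \<longleftrightarrow> supp_neg M w \<phi>"

lemma weight_eq: "weight M t = (\<Sum>\<^sub>\<infinity>w\<in>{w \<in> worlds M. supports M w t}. mass M w)"
  by (cases t) auto

lemma weight_indicator:
  "weight M t = (\<Sum>\<^sub>\<infinity>w\<in>worlds M. of_bool (supports M w t) * mass M w)"
  unfolding weight_eq by (rule infsum_cong_neutral) auto

lemma mass_nonneg: "0 \<le> mass M w"
  by (simp add: mass_def)

text \<open>Every set of states is an event, so finitely many masses add up to a probability.
  Summability of the masses and the upper bound in W1 rest on this.\<close>

lemma sum_mass_le_1:
  assumes "is_prob_bd_model M" "finite F" "F \<subseteq> worlds M"
  shows "sum (mass M) F \<le> 1"
proof -
  interpret prob_space "pr M" using assms(1) by (simp add: is_prob_bd_model_def)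
  have "sum (mass M) F = prob F"
    unfolding mass_def using assms
    by (subst finite_measure_eq_sum_singleton) (auto simp: is_prob_bd_model_def)
  then show ?thesis by simp
qed

lemma mass_summable:
  assumes "is_prob_bd_model M" "A \<subseteq> worlds M"
  shows "mass M summable_on A"
  using assms sum_mass_le_1
  by (intro nonneg_bdd_above_summable_on bdd_aboveI2[where M = 1] mass_nonneg) (auto, blast)

lemma weight_nonneg: "0 \<le> weight M t"
  by (simp add: weight_eq infsum_nonneg mass_nonneg)

lemma weight_le_1:
  assumes "is_prob_bd_model M"
  shows "weight M t \<le> 1"
  unfolding weight_eq
  by (rule infsum_le_finite_sums) (use assms in \<open>auto intro!: mass_summable sum_mass_le_1\<close>)

lemma weight_mono:
  assumes "is_prob_bd_model M" "\<And>w. w \<in> worlds M \<Longrightarrow> supports M w s \<Longrightarrow> supports M w t"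
  shows "weight M s \<le> weight M t"
  unfolding weight_eq
  by (rule infsum_mono_neutral) (use assms in \<open>auto intro!: mass_summable mass_nonneg\<close>)

text \<open>Reduces a linear identity between weights to one between indicators at each single
  state, as used for W3.\<close>

lemma linear_weight:
  assumes "is_prob_bd_model M"
  defines "ind \<equiv> \<lambda>ts w. \<Sum>(a, t)\<leftarrow>ts. real_of_int a * of_bool (supports M w t)"
  shows "((\<lambda>w. ind ts w * mass M w) has_sum (\<Sum>(a, t)\<leftarrow>ts. real_of_int a * weight M t)) (worlds M)"
proof (induction ts)
  case Nil
  then show ?case by (simp add: ind_def)
next
  case (Cons p ts)
  obtain a t where p: "p = (a, t)" by force
  have "(\<lambda>w. of_bool (supports M w t) * mass M w) summable_on worlds M"
  proof (subst summable_on_cong_neutral)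
    show "mass M summable_on {w \<in> worlds M. supports M w t}"
      by (rule mass_summable[OF assms(1)]) auto
  qed auto
  then have "((\<lambda>w. of_bool (supports M w t) * mass M w) has_sum weight M t) (worlds M)"
    unfolding weight_indicator by (rule has_sum_infsum)
  then have "((\<lambda>w. real_of_int a * (of_bool (supports M w t) * mass M w)) has_sum
      real_of_int a * weight M t) (worlds M)"
    by (rule has_sum_cmult_right)
  from has_sum_add[OF this Cons] show ?case
    by (simp add: p ind_def algebra_simps)
qed

section \<open>Inclusion-exclusion by multiplying out a product\<close>

lemma sum_list_subseqs_prod:
  "(\<Sum>ys\<leftarrow>List.subseqs xs. \<Prod>y\<leftarrow>ys. f y) = (\<Prod>x\<leftarrow>xs. 1 + f x :: 'a :: comm_ring_1)"
proof (induction xs)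
  case (Cons x xs)
  then show ?case
    by (simp add: Let_def o_def sum_list_const_mult distrib_right)
qed simp

text \<open>The empty subsequence accounts for the subtracted 1. In the induction the subsequences
  containing the head are all nonempty, so that half is a full expansion.\<close>

lemma sum_list_nonempty_subseqs_prod:
  "(\<Sum>ys\<leftarrow>List.subseqs xs. if ys = [] then 0 else \<Prod>y\<leftarrow>ys. f y)
    = (\<Prod>x\<leftarrow>xs. 1 + f x :: 'a :: comm_ring_1) - 1"
proof (induction xs)
  case (Cons x xs)
  then show ?case
    by (simp add: Let_def o_def sum_list_const_mult sum_list_subseqs_prod distrib_right)
qed simp

lemma supp_pos_big_conj: "\<psi>s \<noteq> [] \<Longrightarrow> supp_pos M w (big_conj \<psi>s) \<longleftrightarrow> (\<forall>\<psi>\<in>set \<psi>s. supp_pos M w \<psi>)"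
  by (induction \<psi>s rule: big_conj.induct) simp_all

lemma supp_pos_big_disj: "\<psi>s \<noteq> [] \<Longrightarrow> supp_pos M w (big_disj \<psi>s) \<longleftrightarrow> (\<exists>\<psi>\<in>set \<psi>s. supp_pos M w \<psi>)"
  by (induction \<psi>s rule: big_disj.induct) simp_all

lemma prod_list_minus_of_bool:
  "(\<Prod>x\<leftarrow>xs. - of_bool (P x)) = (-1) ^ length xs * (of_bool (\<forall>x\<in>set xs. P x) :: 'a :: comm_ring_1)"
  by (induction xs) auto

lemma prod_list_compl_of_bool:
  "(\<Prod>x\<leftarrow>xs. 1 + - of_bool (P x)) = (1 - of_bool (\<exists>x\<in>set xs. P x) :: 'a :: comm_ring_1)"
  by (induction xs) auto

text \<open>Take minus the indicator of support as the factor \<open>f\<close>: products over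
  subsequences become signed indicators of conjunctions, and the product of all \<open>1 + f\<close>
  is 1 minus the indicator of the disjunction.\<close>

lemma inclusion_exclusion_pointwise:
  assumes "\<phi>s \<noteq> []"
  shows "(\<Sum>(a, t)\<leftarrow>(1, Wpos (big_disj \<phi>s)) #
      [((-1) ^ length \<psi>s, Wpos (big_conj \<psi>s)). \<psi>s \<leftarrow> List.subseqs \<phi>s, \<psi>s \<noteq> []].
      real_of_int a * of_bool (supports M w t)) = 0"
proof -
  have "(\<Sum>(a, t)\<leftarrow>[((-1) ^ length \<psi>s, Wpos (big_conj \<psi>s)). \<psi>s \<leftarrow> xss, \<psi>s \<noteq> []].
      real_of_int a * of_bool (supports M w t))
      = (\<Sum>\<psi>s\<leftarrow>xss. if \<psi>s = [] then 0 else \<Prod>\<psi>\<leftarrow>\<psi>s. - of_bool (supp_pos M w \<psi>))" for xss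
    by (induction xss) (auto simp: prod_list_minus_of_bool supp_pos_big_conj)
  then show ?thesis
    using assms
    by (simp add: sum_list_nonempty_subseqs_prod prod_list_compl_of_bool[simplified] supp_pos_big_disj)
qed

text \<open>\<open>bd_entails\<close> speaks of plain models with states in \<open>nat\<close>. It
  is transferred to the state type of \<open>M\<close>, and \<open>N\<close> is \<open>M\<close>
  without its extra record fields.\<close>

lemma bd_entails_supp:
  fixes M :: "('p, 'w, 'e) bd_model_scheme"
  assumes "bd_entails \<phi> \<psi>" "is_bd_model M" "w \<in> worlds M"
  shows "supp_pos M w \<phi> \<Longrightarrow> supp_pos M w \<psi>" "supp_neg M w \<psi> \<Longrightarrow> supp_neg M w \<phi>"
proof -
  define N :: "('p, 'w) bd_model" where "N = \<lparr>worlds = worlds M, vpos = vpos M, vneg = vneg M\<rparr>"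
  have "bd_entails_on TYPE('w) \<phi> \<psi>"
    using assms(1) by (rule bd_entails_on_transfer)
  moreover have "is_bd_model N" "w \<in> worlds N"
    using assms by (auto simp: N_def is_bd_model_def)
  moreover have "(supp_pos M w \<theta> \<longleftrightarrow> supp_pos N w \<theta>) \<and> (supp_neg M w \<theta> \<longleftrightarrow> supp_neg N w \<theta>)" for \<theta>
    by (rule supp_local) (simp_all add: N_def)
  ultimately show "supp_pos M w \<phi> \<Longrightarrow> supp_pos M w \<psi>" "supp_neg M w \<psi> \<Longrightarrow> supp_neg M w \<phi>"
    unfolding bd_entails_on_def by blast+
qed

theorem wBD_sound:
  assumes "wBD \<alpha>" and M: "is_prob_bd_model M"
  shows "satisfies M \<alpha>"
  using assms(1) unfolding satisfies_def
proof induction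
  case (Taut \<beta> \<sigma>)
  then show ?case by (simp add: holds_bsubst tautology_def)
next
  case (Lin \<gamma> \<tau>)
  then show ?case by (simp add: holds_ineq_map valid_linear_def)
next
  case (W3 \<phi>s)
  let ?ts = "(1, Wpos (big_disj \<phi>s)) #
      [((-1) ^ length \<psi>s, Wpos (big_conj \<psi>s)). \<psi>s \<leftarrow> List.subseqs \<phi>s, \<psi>s \<noteq> []]"
  have "((\<lambda>w. 0) has_sum (\<Sum>(a, t)\<leftarrow>?ts. real_of_int a * weight M t)) (worlds M)"
    using linear_weight[OF M, of ?ts]
    by (simp only: inclusion_exclusion_pointwise[OF W3] mult_zero_left)
  then have "(\<Sum>(a, t)\<leftarrow>?ts. real_of_int a * weight M t) = 0"
    by (rule has_sum_unique) simp
  then show ?case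
    unfolding holds_lin_eq by (simp only: of_int_0)
next
  case (W4_pos \<phi> \<phi>')
  have "is_bd_model M" using M by (simp add: is_prob_bd_model_def)
  then show ?case
    unfolding holds_var_le using bd_entails_supp[OF W4_pos] by (intro weight_mono[OF M]) auto
next
  case (W4_neg \<phi> \<phi>')
  have "is_bd_model M" using M by (simp add: is_prob_bd_model_def)
  then show ?case
    unfolding holds_var_le using bd_entails_supp[OF W4_neg] by (intro weight_mono[OF M]) auto
next
  case (W1_pos_le \<phi>)
  then show ?case using weight_le_1[OF M, of "Wpos \<phi>"] by (simp add: holds_lin_le del: weight.simps)
next
  case (W1_neg_le \<phi>)
  then show ?case using weight_le_1[OF M, of "Wneg \<phi>"] by (simp add: holds_lin_le del: weight.simps)
next
  case (W1_pos_ge \<phi>)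
  then show ?case using weight_nonneg[of M "Wpos \<phi>"] by (simp del: weight.simps)
next
  case (W1_neg_ge \<phi>)
  then show ?case using weight_nonneg[of M "Wneg \<phi>"] by (simp del: weight.simps)
qed (auto simp: holds_var_eq)


section \<open>Linear consequences of finitely many theorems\<close>

instance bd :: (countable) countable
  by countable_datatype

instance wterm :: (countable) countable
  by countable_datatype

text \<open>\<open>Lin\<close> starts from inequalities in variables named by numbers:
  \<open>to_nat\<close> numbers the weight terms and \<open>from_nat\<close> substitutes them
  back.\<close>

lemma valid_linear_imp_wBD:
  fixes \<gamma> :: "'p::countable wform"
  assumes "valid_linear \<gamma>"
  shows "wBD \<gamma>"
proof -
  have "valid_linear (map_bform (map_ineq to_nat) \<gamma>)"
    using assms by (simp add: valid_linear_def holds_ineq_map)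
  then have "wBD (map_bform (map_ineq from_nat) (map_bform (map_ineq to_nat) \<gamma>))"
    by (rule Lin)
  moreover have "map_bform (map_ineq from_nat) (map_bform (map_ineq to_nat) \<gamma>) = \<gamma>"
    by (simp add: bform.map_comp ineq.map_comp o_def bform.map_ident ineq.map_ident)
  ultimately show ?thesis by metis
qed

text \<open>The premises move one by one into implications until a valid linear formula remains; MP
  then discharges them.\<close>

lemma wBD_linear_consequence:
  fixes \<alpha> :: "'p::countable wform"
  assumes "finite A" "\<And>\<beta>. \<beta> \<in> A \<Longrightarrow> wBD \<beta>"
    and "\<And>v. (\<And>\<beta>. \<beta> \<in> A \<Longrightarrow> holds (ineq_true v) \<beta>) \<Longrightarrow> holds (ineq_true v) \<alpha>"
  shows "wBD \<alpha>"
  using assms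
proof (induction A arbitrary: \<alpha> rule: finite_induct)
  case empty
  then show ?case by (intro valid_linear_imp_wBD) (simp add: valid_linear_def)
next
  case (insert \<beta> A)
  have "wBD (Imp \<beta> \<alpha>)"
    by (rule insert.IH) (use insert.prems in auto)
  then show ?case using insert.prems(1)[of \<beta>] MP by blast
qed


section \<open>Formulas as up-sets of literal sets\<close>

definition lit_model :: "('p, 'p set \<times> 'p set) bd_model" where
  "lit_model = \<lparr>worlds = UNIV, vpos = (\<lambda>p. {s. p \<in> fst s}), vneg = (\<lambda>p. {s. p \<in> snd s})\<rparr>"

definition ext :: "'p bd \<Rightarrow> ('p set \<times> 'p set) set" where
  "ext \<phi> = {s. supp_pos lit_model s \<phi>}"

lemma ext_BVar: "ext (BVar p) = {s. p \<in> fst s}"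
  and ext_BNeg_BVar: "ext (BNeg (BVar p)) = {s. p \<in> snd s}"
  and ext_BConj: "ext (BConj \<phi> \<psi>) = ext \<phi> \<inter> ext \<psi>"
  and ext_BDisj: "ext (BDisj \<phi> \<psi>) = ext \<phi> \<union> ext \<psi>"
  by (auto simp: ext_def lit_model_def)

definition upset :: "'a::order set \<Rightarrow> bool" where
  "upset U \<longleftrightarrow> (\<forall>s\<in>U. \<forall>t\<ge>s. t \<in> U)"

text \<open>Negation swaps the two kinds of support, so the induction carries persistence of
  both.\<close>

lemma upset_ext: "upset (ext \<phi>)"
proof -
  have "(supp_pos lit_model s \<phi> \<longrightarrow> supp_pos lit_model t \<phi>) \<and>
      (supp_neg lit_model s \<phi> \<longrightarrow> supp_neg lit_model t \<phi>)" if "s \<le> t" for s t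
    using that by (induction \<phi>) (auto simp: lit_model_def less_eq_prod_def)
  then show ?thesis by (auto simp: upset_def ext_def)
qed

text \<open>Without constants in the language, the greatest pair supports every formula in both ways
  and the least pair none in either, so neither \<open>{}\<close> nor \<open>UNIV\<close> is
  definable.\<close>

lemma ext_nonempty: "ext \<phi> \<noteq> {}"
proof -
  have "supp_pos lit_model (UNIV, UNIV) \<phi> \<and> supp_neg lit_model (UNIV, UNIV) \<phi>"
    by (induction \<phi>) (auto simp: lit_model_def)
  then show ?thesis by (auto simp: ext_def)
qed

lemma ext_neq_UNIV: "ext \<phi> \<noteq> UNIV"
proof -
  have "\<not> supp_pos lit_model ({}, {}) \<phi> \<and> \<not> supp_neg lit_model ({}, {}) \<phi>"
    by (induction \<phi>) (auto simp: lit_model_def)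
  then show ?thesis by (auto simp: ext_def)
qed

text \<open>The involution taking \<open>(P, N)\<close> to \<open>(- N, - P)\<close> exchanges
  support of one sign with failure of the other.\<close>

lemma supp_neg_dual: "supp_neg lit_model s \<phi> \<longleftrightarrow> (- snd s, - fst s) \<notin> ext \<phi>"
proof -
  have "(supp_neg lit_model s \<phi> \<longleftrightarrow> \<not> supp_pos lit_model (- snd s, - fst s) \<phi>) \<and>
      (supp_pos lit_model s \<phi> \<longleftrightarrow> \<not> supp_neg lit_model (- snd s, - fst s) \<phi>)"
    by (induction \<phi>) (auto simp: lit_model_def)
  then show ?thesis by (simp add: ext_def)
qed

lemma bd_entails_if_ext_subset:
  assumes "ext \<phi> \<subseteq> ext \<psi>"
  shows "bd_entails \<phi> \<psi>"
proof -
  have "(supp_pos M w \<phi> \<longrightarrow> supp_pos M w \<psi>) \<and> (supp_neg M w \<psi> \<longrightarrow> supp_neg M w \<phi>)"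
    for M :: "('a, nat) bd_model" and w
  proof -
    let ?s = "({p. w \<in> vpos M p}, {p. w \<in> vneg M p})"
    have "(supp_pos M w \<theta> \<longleftrightarrow> supp_pos lit_model ?s \<theta>) \<and>
        (supp_neg M w \<theta> \<longleftrightarrow> supp_neg lit_model ?s \<theta>)" for \<theta>
      by (rule supp_local) (simp_all add: lit_model_def)
    \<comment> \<open>The clause for negative support is the inclusion contraposed at the dual
      pair.\<close>
    then show ?thesis
      using assms by (auto simp: ext_def supp_neg_dual)
  qed
  then show ?thesis unfolding bd_entails_on_def by blast
qed

section \<open>Definability of up-sets by normal forms\<close>

lemma ext_Inter:
  assumes "finite X" "X \<noteq> {}"
  shows "\<exists>\<phi>. ext \<phi> = (\<Inter>\<psi>\<in>X. ext \<psi>)"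
  using assms
  by (induction rule: finite_ne_induct) (auto, metis ext_BConj)

lemma ext_Union:
  assumes "finite X" "X \<noteq> {}"
  shows "\<exists>\<phi>. ext \<phi> = (\<Union>\<psi>\<in>X. ext \<psi>)"
  using assms
  by (induction rule: finite_ne_induct) (auto, metis ext_BDisj)

text \<open>The conjunction of the literals in \<open>s\<close> defines \<open>{s..}\<close>; for
  the least pair this conjunction would be empty.\<close>

lemma ext_atLeast:
  fixes s :: "'p::finite set \<times> 'p set"
  assumes "s \<noteq> ({}, {})"
  shows "\<exists>\<phi>. ext \<phi> = {s..}"
proof -
  let ?X = "BVar ` fst s \<union> (\<lambda>p. BNeg (BVar p)) ` snd s"
  have "?X \<noteq> {}" using assms by (cases s) auto
  moreover have "(\<Inter>\<psi>\<in>?X. ext \<psi>) = {s..}"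
    by (auto simp: ball_Un ext_BVar ext_BNeg_BVar less_eq_prod_def)
  ultimately show ?thesis using ext_Inter[of ?X] by auto
qed

text \<open>Disjunctive normal form: \<open>U\<close> is the union of the principal up-sets of its
  members. The least pair is not among these, since an up-set containing it is
  \<open>UNIV\<close>.\<close>

lemma upset_representable:
  fixes U :: "('p::finite set \<times> 'p set) set"
  assumes "upset U" "U \<noteq> {}" "U \<noteq> UNIV"
  shows "\<exists>\<phi>. ext \<phi> = U"
proof -
  have "s \<noteq> ({}, {})" if "s \<in> U" for s
    using that assms by (auto simp: upset_def less_eq_prod_def)
  then obtain r where r: "\<And>s. s \<in> U \<Longrightarrow> ext (r s) = {s..}"
    using ext_atLeast by metis
  have "(\<Union>\<psi>\<in>r ` U. ext \<psi>) = U"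
    using assms(1) r by (auto simp: upset_def)
  then show ?thesis using ext_Union[of "r ` U"] assms by auto
qed

text \<open>Remove a minimal \<open>s\<close> from \<open>U\<close>: the up-sets
  \<open>U - {s}\<close> and \<open>{s..}\<close> have union \<open>U\<close> and intersection
  \<open>{s<..}\<close>, so modularity yields exactly the summand of \<open>s\<close>.\<close>

lemma modular_eq_sum:
  fixes g :: "'s::{finite, order} set \<Rightarrow> real"
  assumes "g {} = 0"
    and modular: "\<And>U V. upset U \<Longrightarrow> upset V \<Longrightarrow> g (U \<union> V) + g (U \<inter> V) = g U + g V"
    and "upset U"
  shows "g U = (\<Sum>s\<in>U. g {s..} - g {s<..})"
proof -
  have "finite U" by simp
  then show ?thesis using assms(3)
  proof (induction U rule: finite_psubset_induct)
    case (psubset U)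
    show ?case
    proof (cases "U = {}")
      case True
      then show ?thesis using assms(1) by simp
    next
      case False
      then obtain s where s: "s \<in> U" and min: "\<And>t. t \<in> U \<Longrightarrow> t \<le> s \<Longrightarrow> t = s"
        using finite_has_minimal[OF psubset.hyps] by metis
      have up: "upset (U - {s})" "upset {s..}"
        using psubset.prems min by (auto simp: upset_def)
      have "(U - {s}) \<union> {s..} = U" "(U - {s}) \<inter> {s..} = {s<..}"
        using psubset.prems s by (auto simp: upset_def less_le)
      then have "g U = g (U - {s}) + (g {s..} - g {s<..})"
        using modular[OF up] by simp
      also have "g (U - {s}) = (\<Sum>s\<in>U - {s}. g {s..} - g {s<..})"
        using s up by (intro psubset.IH) auto
      finally show ?thesis using s by (simp add: sum.remove)
    qed
  qed
qed


section \<open>Completeness\<close>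

definition rep :: "('p set \<times> 'p set) set \<Rightarrow> 'p bd" where
  "rep U = (SOME \<phi>. ext \<phi> = U)"

lemma ext_rep_ext: "ext (rep (ext \<phi>)) = ext \<phi>"
  unfolding rep_def by (rule someI) (rule refl)

primrec pos_form :: "'p wterm \<Rightarrow> 'p bd" where
  "pos_form (Wpos \<phi>) = \<phi>"
| "pos_form (Wneg \<phi>) = BNeg \<phi>"

lemma supports_pos_form: "supports M w t \<longleftrightarrow> supp_pos M w (pos_form t)"
  by (cases t) auto

text \<open>These are the formulas whose weights get compared: representatives, the binary joins and
  meets that W3 mentions, and the formulas from \<open>T\<close>. The representative of an
  undefinable set is arbitrary, but the axioms about it are theorems all the same.\<close>

definition rel_forms :: "'p wterm set \<Rightarrow> 'p bd set" where
  "rel_forms T = range rep \<union> (\<lambda>(U, V). BDisj (rep U) (rep V)) ` UNIV \<union>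
     (\<lambda>(U, V). BConj (rep U) (rep V)) ` UNIV \<union> pos_form ` T"

definition W3_binary :: "'p bd \<Rightarrow> 'p bd \<Rightarrow> 'p wform" where
  "W3_binary \<phi> \<psi> = lin_eq [(1, Wpos (BDisj \<phi> \<psi>)), (1, Wpos (BConj \<phi> \<psi>)),
     (- 1, Wpos \<phi>), (- 1, Wpos \<psi>)] 0"

definition axioms_for :: "'p wterm set \<Rightarrow> 'p wform set" where
  "axioms_for T =
     (\<lambda>\<phi>. lin_ge [(1, Wpos \<phi>)] 0) ` rel_forms T \<union>
     (\<lambda>\<phi>. lin_le [(1, Wpos \<phi>)] 1) ` rel_forms T \<union>
     (\<lambda>t. var_eq t (Wpos (pos_form t))) ` T \<union>
     (\<lambda>(U, V). W3_binary (rep U) (rep V)) ` UNIV \<union>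
     (\<lambda>(\<phi>, \<psi>). var_le (Wpos \<phi>) (Wpos \<psi>)) `
       {(\<phi>, \<psi>) \<in> rel_forms T \<times> rel_forms T. ext \<phi> \<subseteq> ext \<psi>}"

lemma finite_axioms_for:
  fixes T :: "'p::finite wterm set"
  assumes "finite T"
  shows "finite (axioms_for T)"
proof -
  have "finite (rel_forms T)"
    using assms by (simp add: rel_forms_def)
  then show ?thesis
    using assms by (auto simp: axioms_for_def intro: finite_subset[OF _ finite_cartesian_product])
qed

lemma wBD_W3_binary:
  fixes \<phi> \<psi> :: "'p::countable bd"
  shows "wBD (W3_binary \<phi> \<psi>)"
proof (rule wBD_linear_consequence)
  let ?A = "lin_eq ((1, Wpos (big_disj [\<phi>, \<psi>])) #
      [((-1) ^ length \<psi>s, Wpos (big_conj \<psi>s)). \<psi>s \<leftarrow> List.subseqs [\<phi>, \<psi>], \<psi>s \<noteq> []]) 0"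
  show "wBD \<beta>" if "\<beta> \<in> {?A}" for \<beta>
    using that W3[of "[\<phi>, \<psi>]"] by auto
  show "holds (ineq_true v) (W3_binary \<phi> \<psi>)" if "\<And>\<beta>. \<beta> \<in> {?A} \<Longrightarrow> holds (ineq_true v) \<beta>" for v
  proof -
    have "holds (ineq_true v) ?A" by (rule that) simp
    then show ?thesis
      unfolding W3_binary_def holds_lin_eq by (simp add: algebra_simps)
  qed
qed simp

lemma wBD_axioms_for:
  fixes T :: "'p::countable wterm set"
  assumes "\<beta> \<in> axioms_for T"
  shows "wBD \<beta>"
proof -
  have "wBD (var_eq t (Wpos (pos_form t)))" for t :: "'p wterm"
  proof (cases t)
    case (Wpos \<phi>)
    then show ?thesis
      by (auto intro!: valid_linear_imp_wBD simp: valid_linear_def holds_var_eq)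
  qed (auto intro: W2_neg)
  then show ?thesis
    using assms unfolding axioms_for_def
    by (auto intro: W1_pos_ge W1_pos_le W4_pos wBD_W3_binary bd_entails_if_ext_subset)
qed

lemma mass_function_of_valuation:
  fixes T :: "'p::finite wterm set" and v :: "'p wterm \<Rightarrow> real"
  assumes "\<And>\<beta>. \<beta> \<in> axioms_for T \<Longrightarrow> holds (ineq_true v) \<beta>"
  shows "\<exists>m :: 'p set \<times> 'p set \<Rightarrow> real.
    (\<forall>s. 0 \<le> m s) \<and> sum m UNIV = 1 \<and> (\<forall>t\<in>T. v t = sum m (ext (pos_form t)))"
proof -
  let ?F = "rel_forms T"
  have ge0: "0 \<le> v (Wpos \<phi>)" if "\<phi> \<in> ?F" for \<phi>
    using assms[of "lin_ge [(1, Wpos \<phi>)] 0"] that by (auto simp: axioms_for_def)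
  have le1: "v (Wpos \<phi>) \<le> 1" if "\<phi> \<in> ?F" for \<phi>
    using assms[of "lin_le [(1, Wpos \<phi>)] 1"] that by (auto simp: axioms_for_def holds_lin_le)
  have pos: "v t = v (Wpos (pos_form t))" if "t \<in> T" for t
    using assms[of "var_eq t (Wpos (pos_form t))"] that by (auto simp: axioms_for_def holds_var_eq)
  have mono: "v (Wpos \<phi>) \<le> v (Wpos \<psi>)" if "\<phi> \<in> ?F" "\<psi> \<in> ?F" "ext \<phi> \<subseteq> ext \<psi>" for \<phi> \<psi>
    using assms[of "var_le (Wpos \<phi>) (Wpos \<psi>)"] that
    by (force simp: axioms_for_def holds_var_le)
  have W3v: "v (Wpos (BDisj (rep U) (rep V))) + v (Wpos (BConj (rep U) (rep V)))
      = v (Wpos (rep U)) + v (Wpos (rep V))" for U V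
    using assms[of "W3_binary (rep U) (rep V)"]
    by (force simp: axioms_for_def W3_binary_def holds_lin_eq)
  have F: "rep U \<in> ?F" "BDisj (rep U) (rep V) \<in> ?F" "BConj (rep U) (rep V) \<in> ?F"
    "t \<in> T \<Longrightarrow> pos_form t \<in> ?F" for U V t
    by (auto simp: rel_forms_def)
  \<comment> \<open>No formula defines \<open>{}\<close> or \<open>UNIV\<close>, so they get the
    values of a probability, and W1 keeps \<open>g\<close> monotone there. The value 1 at
    \<open>UNIV\<close> assigns the remaining mass to the least pair.\<close>
  define g where "g U = (if U = {} then 0 else if U = UNIV then 1 else v (Wpos (rep U)))"
    for U :: "('p set \<times> 'p set) set"
  \<comment> \<open>W4 in both directions equates the values of a formula and of the representative
    of its extension.\<close>
  have g_ext: "g (ext \<phi>) = v (Wpos \<phi>)" if "\<phi> \<in> ?F" for \<phi>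
    using mono[OF that F(1)[of "ext \<phi>"]] mono[OF F(1)[of "ext \<phi>"] that]
    by (auto simp: g_def ext_nonempty ext_neq_UNIV ext_rep_ext)
  have rep_cases: "U = {} \<or> U = UNIV \<or> ext (rep U) = U" if "upset U" for U :: "('p set \<times> 'p set) set"
    using upset_representable[OF that] ext_rep_ext by blast
  have modular: "g (U \<union> V) + g (U \<inter> V) = g U + g V" if up: "upset U" "upset V" for U V
  proof -
    \<comment> \<open>If one of the sets is trivial, \<open>U \<union> V\<close> and
      \<open>U \<inter> V\<close> are \<open>U\<close> and \<open>V\<close> in some order; otherwise
      W3 applies to the representatives.\<close>
    consider "U = {} \<or> U = UNIV \<or> V = {} \<or> V = UNIV" | "ext (rep U) = U" "ext (rep V) = V"
      using rep_cases[OF up(1)] rep_cases[OF up(2)] by blast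
    then show ?thesis
    proof cases
      case 1
      then show ?thesis by (auto simp: g_def)
    next
      case 2
      then show ?thesis
        using W3v[of U V] F g_ext[of "rep U"] g_ext[of "rep V"]
          g_ext[of "BDisj (rep U) (rep V)"] g_ext[of "BConj (rep U) (rep V)"]
        by (simp add: ext_BConj ext_BDisj)
    qed
  qed
  have g_mono: "g U \<le> g V" if "upset U" "upset V" "U \<subseteq> V" for U V
    using rep_cases[OF that(1)] rep_cases[OF that(2)] that(3) ge0[OF F(1)] le1[OF F(1)]
      mono[OF F(1)[of U] F(1)[of V]]
    by (auto simp: g_def)
  define m where "m s = g {s..} - g {s<..}" for s
  have g_sum: "g U = sum m U" if "upset U" for U
    unfolding m_def by (rule modular_eq_sum) (use that modular in \<open>auto simp: g_def\<close>)
  have "0 \<le> m s" for s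
    unfolding m_def diff_ge_0_iff_ge
    by (rule g_mono) (auto simp only: upset_def greaterThan_iff atLeast_iff
      intro: order.trans order.strict_implies_order order.strict_trans2)
  moreover have "sum m UNIV = 1"
    using g_sum[of UNIV] by (simp add: g_def upset_def)
  moreover have "v t = sum m (ext (pos_form t))" if "t \<in> T" for t
    using pos[OF that] g_ext[OF F(4)[OF that]] g_sum[OF upset_ext] by simp
  ultimately show ?thesis by blast
qed

text \<open>An infinite type has room for a copy of the finitely many pairs; literals and masses are
  carried along the injection \<open>e\<close>.\<close>

lemma model_of_mass_function:
  fixes m :: "'p::finite set \<times> 'p set \<Rightarrow> real"
  assumes nonneg: "\<And>s. 0 \<le> m s" and total: "sum m UNIV = 1" and "infinite (UNIV :: 'w set)"
  shows "\<exists>M :: ('p, 'w) prob_bd_model. is_prob_bd_model M \<and>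
    (\<forall>t. weight M t = sum m (ext (pos_form t)))"
proof -
  obtain e :: "'p set \<times> 'p set \<Rightarrow> 'w" where e: "inj e"
  proof -
    obtain B :: "'w set" where "finite B" "card B = card (UNIV :: ('p set \<times> 'p set) set)"
      using infinite_arbitrarily_large[OF assms(3)] by blast
    then show ?thesis
      using that finite_same_card_bij[of "UNIV :: ('p set \<times> 'p set) set" B]
      by (auto simp: bij_betw_def)
  qed
  define \<mu> where "\<mu> = point_measure (range e) (\<lambda>w. ennreal (m (inv e w)))"
  define M :: "('p, 'w) prob_bd_model" where
    "M = \<lparr>worlds = range e, vpos = (\<lambda>p. e ` {s. p \<in> fst s}), vneg = (\<lambda>p. e ` {s. p \<in> snd s}),
      pr = \<mu>\<rparr>"
  have em: "emeasure \<mu> (e ` S) = ennreal (sum m S)" for S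
    unfolding \<mu>_def using e nonneg
    by (subst emeasure_point_measure_finite) (auto simp: sum.reindex inj_on_subset sum_ennreal)
  have "is_prob_bd_model M"
    unfolding is_prob_bd_model_def is_bd_model_def
    using em[of UNIV] total
    by (auto simp: M_def \<mu>_def space_point_measure sets_point_measure intro!: prob_spaceI)
  moreover have "weight M t = sum m (ext (pos_form t))" for t
  proof -
    have mass: "mass M (e s) = m s" for s
      using em[of "{s}"] nonneg by (simp add: mass_def measure_def M_def)
    have "supp_pos M (e s) \<phi> \<longleftrightarrow> s \<in> ext \<phi>" for s \<phi>
      unfolding ext_def mem_Collect_eq
      by (rule supp_local[THEN conjunct1]) (auto simp: M_def lit_model_def inj_image_mem_iff[OF e])
    then have "{w \<in> worlds M. supports M w t} = e ` ext (pos_form t)"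
      by (auto simp: supports_pos_form M_def)
    then show ?thesis
      using e by (simp add: weight_eq sum.reindex inj_on_subset mass)
  qed
  ultimately show ?thesis by blast
qed

section \<open>From valuations to models\<close>

definition wterms :: "'x ineq bform \<Rightarrow> 'x set" where
  "wterms \<alpha> = (\<Union>i\<in>set_bform \<alpha>. set_ineq i)"

lemma finite_wterms: "finite (wterms \<alpha>)"
proof -
  have "finite (set_bform \<beta>)" for \<beta> :: "'b bform"
    by (induction \<beta>) auto
  moreover have "finite (set_ineq i)" for i :: "'b ineq"
    by (cases i) auto
  ultimately show ?thesis by (simp add: wterms_def)
qed

lemma ineq_true_cong:
  assumes "\<And>x. x \<in> set_ineq i \<Longrightarrow> v x = u x"
  shows "ineq_true v i \<longleftrightarrow> ineq_true u i"
proof (cases i)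
  case (Ineq ts c)
  then have "map (\<lambda>(a, x). real_of_int a * v x) ts = map (\<lambda>(a, x). real_of_int a * u x) ts"
    using assms by (force simp: snds.simps)
  then show ?thesis using Ineq by (simp only: ineq_true.simps)
qed

lemma holds_ineq_cong:
  assumes "\<And>x. x \<in> wterms \<alpha> \<Longrightarrow> v x = u x"
  shows "holds (ineq_true v) \<alpha> \<longleftrightarrow> holds (ineq_true u) \<alpha>"
  using assms
proof (induction \<alpha>)
  case (FAtom i)
  then show ?case by (auto simp: wterms_def intro!: ineq_true_cong)
qed (auto simp: wterms_def)

text \<open>A valuation satisfying the chosen axioms agrees on the weight terms of
  \<open>\<alpha>\<close> with the weights of a model, where \<open>\<alpha>\<close> holds by
  validity. So \<open>\<alpha>\<close> is a linear consequence of finitely many theorems.\<close>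

theorem wBD_complete:
  fixes \<alpha> :: "'p::finite wform"
  assumes "infinite (UNIV :: 'w set)" "valid_on TYPE('w) \<alpha>"
  shows "wBD \<alpha>"
proof (rule wBD_linear_consequence[of "axioms_for (wterms \<alpha>)"])
  fix v assume "\<And>\<beta>. \<beta> \<in> axioms_for (wterms \<alpha>) \<Longrightarrow> holds (ineq_true v) \<beta>"
  then obtain m :: "'p set \<times> 'p set \<Rightarrow> real" where m: "\<And>s. 0 \<le> m s" "sum m UNIV = 1"
    "\<And>t. t \<in> wterms \<alpha> \<Longrightarrow> v t = sum m (ext (pos_form t))"
    using mass_function_of_valuation by metis
  obtain M :: "('p, 'w) prob_bd_model" where M: "is_prob_bd_model M"
    "\<And>t. weight M t = sum m (ext (pos_form t))"
    using model_of_mass_function[OF m(1,2) assms(1)] by blast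
  have "holds (ineq_true (weight M)) \<alpha>"
    using assms(2) M(1) by (auto simp: valid_on_def satisfies_def)
  then show "holds (ineq_true v) \<alpha>"
    using holds_ineq_cong[of \<alpha> v "weight M"] m(3) M(2) by simp
qed (auto simp: finite_axioms_for finite_wterms intro: wBD_axioms_for)

text \<open>Validity has the state type as a parameter, so the claim about all models splits:
  soundness over any type \<open>'v\<close>, and derivability already from validity over one
  infinite type. The sort \<open>finite\<close> expresses that there are finitely many
  variables.\<close>

theorem mainTheorem3:
  fixes \<alpha> :: "'p::finite wform"
  assumes "infinite (UNIV :: 'w set)"
  shows "(wBD \<alpha> \<longleftrightarrow> valid_on TYPE('w) \<alpha>) \<and> (wBD \<alpha> \<longrightarrow> valid_on TYPE('v) \<alpha>)"
proof -
  have "valid_on TYPE('w) \<alpha>" "valid_on TYPE('v) \<alpha>" if "wBD \<alpha>"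
    using wBD_sound[OF that] by (auto simp only: valid_on_def)
  with wBD_complete[OF assms] show ?thesis by blast
qed

end
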